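(* Let $Q=(T,\phi,h)$ be a generalized convex polyhedron such that $$\kappa_i>0,\quad h_i>0,\quad F_i>0\qquad\text{for all } i\in\mathcal V(T),$$ where $\kappa_i$ is the curvature, $h_i$ is the altitude, and $F_i$ is the area of the $i$-th face. Then the Hessian of the volume at $Q$ is non-degenerate: $$\det\left(\frac{\partial^2\mathrm{vol}}{\partial h_i\,\partial h_j}\right)\neq0 .$$
   Context: A generalized simplicial fan is a couple $(T,\phi)$, where $T$ is a triangulation of the sphere (loops and multiple edges allowed) with vertex, edge, face sets $\mathcal V(T),\mathcal E(T),\mathcal F(T)$ and $\phi:\mathcal E(T)\to(0,\pi)$ is a map such that for each triangle $ijk\in\mathcal F(T)$ there exists a spherical triangle with side lengths $\phi_{ij},\phi_{jk},\phi_{ik}$. Let $h:\mathcal V(T)\to\mathbb{R}$ (altitudes). For an oriented edge $e$ from $i$ to $j$ put $h_e=\dfrac{h_j-h_i\cos\phi_e}{\sin\phi_e}$, where $\phi_e=\phi_{-e}$. For a vertex $i$ let $e_1,\ldots,e_m$ be the oriented edges starting at $i$ in cyclic order (indices mod $m$) and let $\omega_s\in(0,\pi)$ be the angle at $i$, between $e_s$ and $e_{s+1}$, of the corresponding spherical triangle of the fan. Put $$\ell^*_{e_s}=\frac{h_{e_{s+1}}-h_{e_s}\cos\omega_s}{\sin\omega_s}+\frac{h_{e_{s-1}}-h_{e_s}\cos\omega_{s-1}}{\sin\omega_{s-1}},$$ $$F_i=\frac12\sum_{s=1}^m h_{e_s}\ell^*_{e_s},\qquad \mathrm{vol}=\frac13\sum_{i\in\mathcal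 V(T)}h_iF_i .$$ The triple $Q=(T,\phi,h)$ is a generalized convex polyhedron if $\ell^*_e\ge0$ for every edge $e$ ($\ell^*_e$ does not depend on the orientation of $e$). $F_i$ is called the area of the $i$-th face and $\mathrm{vol}$ the volume. For fixed $(T,\phi)$, $\mathrm{vol}$ is a homogeneous cubic polynomial in $(h_i)$, and the Hessian is taken with $(T,\phi)$ fixed. The curvature $\kappa_i$ of $Q$ is the curvature of the spherical section at $i$: $\kappa_i=2\pi-\sum_{s=1}^m\omega_s$. *)

theory Defs
  imports "HOL-Analysis.Analysis" "HOL-Combinatorics.Orbits"
begin

subsection \<open>Triangulations of the sphere\<close>

text \<open>
  A triangulation, loops and multiple edges allowed, is encoded as a combinatorial map.
  The type \<open>'e\<close> is the set of oriented edges and \<open>'v\<close> the set of vertices; \<open>org e\<close> is the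
  starting point of \<open>e\<close>, \<open>opp e\<close> is \<open>e\<close> with the reversed orientation, and \<open>ccw e\<close> is the
  successor of \<open>e\<close> in the cyclic order of the oriented edges starting at \<open>org e\<close>.
  A loop occurs twice in the cyclic order at its vertex, as \<open>e\<close> and as \<open>opp e\<close>.
\<close>

record ('e, 'v) tri_map =
  org :: "'e \<Rightarrow> 'v"
  opp :: "'e \<Rightarrow> 'e"
  ccw :: "'e \<Rightarrow> 'e"

definition cw :: "('e, 'v, 'z) tri_map_scheme \<Rightarrow> 'e \<Rightarrow> 'e" where
  "cw T = inv (ccw T)"

definition dest :: "('e, 'v, 'z) tri_map_scheme \<Rightarrow> 'e \<Rightarrow> 'v" where
  "dest T e = org T (opp T e)"

text \<open>
  The face between \<open>e\<close> and \<open>ccw T e\<close> is traversed starting with \<open>e\<close>. If it is the triangle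
  \<open>ijk\<close>, with \<open>e\<close> from \<open>i\<close> to \<open>j\<close> and \<open>ccw T e\<close> from \<open>i\<close> to \<open>k\<close>, then the next edge runs
  from \<open>j\<close> to \<open>k\<close>, because its successor around \<open>j\<close> is \<open>opp T e\<close>.
\<close>

definition face_next :: "('e, 'v, 'z) tri_map_scheme \<Rightarrow> 'e \<Rightarrow> 'e" where
  "face_next T e = cw T (opp T e)"

definition edges :: "('e, 'v, 'z) tri_map_scheme \<Rightarrow> 'e set set" where
  "edges T = range (\<lambda>e. {e, opp T e})"

definition faces :: "('e, 'v, 'z) tri_map_scheme \<Rightarrow> 'e set set" where
  "faces T = range (orbit (face_next T))"

text \<open>
  The vertices correspond to the orbits of \<open>ccw\<close>. Connectedness and Euler characteristic 2
  say that the closed oriented surface glued from the faces is the sphere.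
\<close>

definition sphere_triangulation :: "('e::finite, 'v::finite, 'z) tri_map_scheme \<Rightarrow> bool" where
  "sphere_triangulation T \<longleftrightarrow>
     (\<forall>e. opp T (opp T e) = e \<and> opp T e \<noteq> e) \<and>
     bij (ccw T) \<and>
     surj (org T) \<and>
     (\<forall>e e'. org T e = org T e' \<longleftrightarrow> e' \<in> orbit (ccw T) e) \<and>
     (\<forall>f\<in>faces T. card f = 3) \<and>
     (\<forall>e e'. (e, e') \<in> {(x, y). y = opp T x \<or> y = ccw T x}\<^sup>*) \<and>
     int CARD('v) - int (card (edges T)) + int (card (faces T)) = 2"


subsection \<open>Spherical triangles\<close>

text \<open>
  Vertices on the unit sphere, not on a common great circle. The sides are the minimal
  great circle arcs.
\<close>

definition spherical_triangle :: "real^3 \<Rightarrow> real^3 \<Rightarrow> real^3 \<Rightarrow> bool" where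
  "spherical_triangle x y z \<longleftrightarrow>
     norm x = 1 \<and> norm y = 1 \<and> norm z = 1 \<and> distinct [x, y, z] \<and> independent {x, y, z}"

definition sph_dist :: "real^3 \<Rightarrow> real^3 \<Rightarrow> real" where
  "sph_dist x y = arccos (x \<bullet> y)"

text \<open>The vector at \<open>x\<close>, tangent to the sphere, pointing along the great circle arc to \<open>y\<close>.\<close>

definition sph_dir :: "real^3 \<Rightarrow> real^3 \<Rightarrow> real^3" where
  "sph_dir x y = y - (x \<bullet> y) *\<^sub>R x"

definition sph_angle :: "real^3 \<Rightarrow> real^3 \<Rightarrow> real^3 \<Rightarrow> real" where
  "sph_angle x y z =
     arccos ((sph_dir x y \<bullet> sph_dir x z) / (norm (sph_dir x y) * norm (sph_dir x z)))"

definition has_sides :: "real^3 \<Rightarrow> real^3 \<Rightarrow> real^3 \<Rightarrow> real \<Rightarrow> real \<Rightarrow> real \<Rightarrow> bool" where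
  "has_sides x y z a b c \<longleftrightarrow>
     spherical_triangle x y z \<and> sph_dist x y = a \<and> sph_dist x z = b \<and> sph_dist y z = c"

text \<open>The angle enclosed by the sides \<open>a\<close> and \<open>b\<close> and opposite to the side \<open>c\<close>.\<close>

definition angle_of_sides :: "real \<Rightarrow> real \<Rightarrow> real \<Rightarrow> real" where
  "angle_of_sides a b c = (THE w. \<exists>x y z. has_sides x y z a b c \<and> w = sph_angle x y z)"

lemma norm_sph_dir:
  assumes "norm x = 1" "norm y = 1"
  shows "norm (sph_dir x y) = sin (sph_dist x y)"
proof -
  have xx: "x \<bullet> x = 1" and yy: "y \<bullet> y = 1"
    using assms by (simp_all add: norm_eq_1)
  have bound: "\<bar>x \<bullet> y\<bar> \<le> 1"
    using Cauchy_Schwarz_ineq2[of x y] assms by simp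
  have "sph_dir x y \<bullet> sph_dir x y = 1 - (x \<bullet> y)\<^sup>2"
    by (simp add: sph_dir_def inner_diff_left inner_diff_right xx yy inner_commute
        power2_eq_square algebra_simps)
  then show ?thesis
    using bound by (simp add: norm_eq_sqrt_inner sph_dist_def sin_arccos)
qed

lemma spherical_law_of_cosines:
  assumes "has_sides x y z a b c"
  shows "sph_angle x y z = arccos ((cos c - cos a * cos b) / (sin a * sin b))"
proof -
  have n: "norm x = 1" "norm y = 1" "norm z = 1"
    and a: "a = sph_dist x y" and b: "b = sph_dist x z" and c: "c = sph_dist y z"
    using assms by (auto simp: has_sides_def spherical_triangle_def)
  have xx: "x \<bullet> x = 1"
    using n by (simp add: norm_eq_1)
  have cosd: "cos (sph_dist u v) = u \<bullet> v" if "norm u = 1" "norm v = 1" for u v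
    using Cauchy_Schwarz_ineq2[of u v] that by (simp add: sph_dist_def cos_arccos_abs)
  have "sph_dir x y \<bullet> sph_dir x z = y \<bullet> z - (x \<bullet> y) * (x \<bullet> z)"
    by (simp add: sph_dir_def inner_diff_left inner_diff_right xx inner_commute algebra_simps)
  then show ?thesis
    unfolding sph_angle_def by (simp add: norm_sph_dir n a b c cosd)
qed

lemma angle_of_sides_eq:
  assumes "has_sides x y z a b c"
  shows "angle_of_sides a b c = sph_angle x y z"
  unfolding angle_of_sides_def
proof (rule the_equality)
  show "\<exists>u v w. has_sides u v w a b c \<and> sph_angle x y z = sph_angle u v w"
    using assms by blast
qed (use assms spherical_law_of_cosines in auto)


subsection \<open>Generalized simplicial fans\<close>

definition generalized_fan ::
  "('e::finite, 'v::finite, 'z) tri_map_scheme \<Rightarrow> ('e \<Rightarrow> real) \<Rightarrow> bool" where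
  "generalized_fan T \<phi> \<longleftrightarrow>
     sphere_triangulation T \<and>
     (\<forall>e. \<phi> (opp T e) = \<phi> e \<and> 0 < \<phi> e \<and> \<phi> e < pi) \<and>
     (\<forall>e. \<exists>x y z. has_sides x y z (\<phi> e) (\<phi> (ccw T e)) (\<phi> (face_next T e)))"

text \<open>The angle at \<open>org T e\<close> between \<open>e\<close> and \<open>ccw T e\<close>.\<close>

definition fan_angle :: "('e, 'v, 'z) tri_map_scheme \<Rightarrow> ('e \<Rightarrow> real) \<Rightarrow> 'e \<Rightarrow> real" where
  "fan_angle T \<phi> e = angle_of_sides (\<phi> e) (\<phi> (ccw T e)) (\<phi> (face_next T e))"

definition curvature :: "('e::finite, 'v, 'z) tri_map_scheme \<Rightarrow> ('e \<Rightarrow> real) \<Rightarrow> 'v \<Rightarrow> real" where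
  "curvature T \<phi> i = 2 * pi - (\<Sum>e | org T e = i. fan_angle T \<phi> e)"


subsection \<open>Altitudes, areas and volume\<close>

definition edge_alt ::
  "('e, 'v::finite, 'z) tri_map_scheme \<Rightarrow> ('e \<Rightarrow> real) \<Rightarrow> real^'v \<Rightarrow> 'e \<Rightarrow> real" where
  "edge_alt T \<phi> h e = (h $ dest T e - h $ org T e * cos (\<phi> e)) / sin (\<phi> e)"

definition dual_length ::
  "('e, 'v::finite, 'z) tri_map_scheme \<Rightarrow> ('e \<Rightarrow> real) \<Rightarrow> real^'v \<Rightarrow> 'e \<Rightarrow> real" where
  "dual_length T \<phi> h e =
     (edge_alt T \<phi> h (ccw T e) - edge_alt T \<phi> h e * cos (fan_angle T \<phi> e))
       / sin (fan_angle T \<phi> e) +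
     (edge_alt T \<phi> h (cw T e) - edge_alt T \<phi> h e * cos (fan_angle T \<phi> (cw T e)))
       / sin (fan_angle T \<phi> (cw T e))"

definition face_area ::
  "('e::finite, 'v::finite, 'z) tri_map_scheme \<Rightarrow> ('e \<Rightarrow> real) \<Rightarrow> real^'v \<Rightarrow> 'v \<Rightarrow> real" where
  "face_area T \<phi> h i =
     1/2 * (\<Sum>e | org T e = i. edge_alt T \<phi> h e * dual_length T \<phi> h e)"

definition vol ::
  "('e::finite, 'v::finite, 'z) tri_map_scheme \<Rightarrow> ('e \<Rightarrow> real) \<Rightarrow> real^'v \<Rightarrow> real" where
  "vol T \<phi> h = 1/3 * (\<Sum>i\<in>UNIV. h $ i * face_area T \<phi> h i)"

definition generalized_convex_polyhedron ::
  "('e::finite, 'v::finite, 'z) tri_map_scheme \<Rightarrow> ('e \<Rightarrow> real) \<Rightarrow> real^'v \<Rightarrow> bool" where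
  "generalized_convex_polyhedron T \<phi> h \<longleftrightarrow>
     generalized_fan T \<phi> \<and> (\<forall>e. 0 \<le> dual_length T \<phi> h e)"


subsection \<open>Hessian matrix\<close>

definition partial :: "'n::finite \<Rightarrow> (real^'n \<Rightarrow> real) \<Rightarrow> real^'n \<Rightarrow> real" where
  "partial i f x = deriv (\<lambda>t. f (x + t *\<^sub>R axis i 1)) 0"

definition hessian :: "(real^'n::finite \<Rightarrow> real) \<Rightarrow> real^'n \<Rightarrow> real^'n^'n" where
  "hessian f x = (\<chi> i j. partial i (partial j f) x)"

end

theory Submission
  imports Defs
begin

text \<open>
  Three times the volume is a cubic form with polarization \<open>mixed_volume\<close>, a weighted sum of mixed
  areas of the faces: \<open>mixed_volume h x y\<close> is the sum of \<open>h\<^sub>i * mixed_area x y i\<close> over the vertices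
  \<open>i\<close>. It is symmetric in all three arguments. For \<open>x\<close> and \<open>y\<close> this is summation by parts around a vertex. For
  \<open>h\<close> and \<open>x\<close> it holds because the dual length of an edge is the same at both of its ends, which is a
  computation in each spherical triangle (\<open>triangle_foot_symmetric\<close>). Consequently the Hessian
  maps \<open>v\<close> to twice the vector of the mixed areas of \<open>h\<close> and \<open>v\<close>.

  Let \<open>v\<close> be in the kernel. Then \<open>mixed_area h v i = 0\<close> at every vertex, and
  \<open>mixed_volume h v v = mixed_volume v h v = 0\<close>. The local fact behind the theorem is
  Minkowski's inequality in dimension two, on a cone of angle less than \<open>2\<pi>\<close>: the area form of a
  vertex has only one positive direction. As \<open>h\<close> has positive area, \<open>mixed_area v v i \<le> 0\<close>, with
  equality only if \<open>v\<close> has zero altitudes along all edges at \<open>i\<close> (\<open>mixed_area_lorentzian\<close>). The sum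
  of \<open>h\<^sub>i * mixed_area v v i\<close> vanishes and \<open>h\<^sub>i > 0\<close>, so equality holds everywhere, and then
  \<open>v = 0\<close>.

  For the local fact, twice the area is the energy of \<open>p\<close>, the integral of \<open>p\<^sup>2 - p'\<^sup>2\<close> over the circle of length
  \<open>\<theta> < 2\<pi>\<close>, where \<open>p\<close> interpolates the altitudes of the edges trigonometrically. The usual route
  to its signature is Wirtinger's inequality. The proof below uses instead that every plane of such
  functions contains a nonzero one that vanishes at two points dividing the circle into halves
  (\<open>nonpos_combination_exists\<close>). The halves are shorter than \<open>\<pi>\<close>, so that function has non-positive
  energy, by Picone's identity (\<open>closed_arc_form_nonpos\<close>). The case of equality reduces to the
  kernel of the form, which is trivial because of the holonomy \<open>\<theta>\<close> of the cone
  (\<open>straight_imp_zero\<close>).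
\<close>

section \<open>Piecewise trigonometric functions on an interval\<close>

text \<open>
  If \<open>p'' = - p\<close> on an arc of length \<open>w < pi\<close> with end values \<open>a\<close> and \<open>b\<close>, then \<open>arc_form w a b\<close> is
  the integral of \<open>p\<^sup>2 - p'\<^sup>2\<close> over the arc. This integral is called the energy of \<open>p\<close>.
\<close>
definition arc_form :: "real \<Rightarrow> real \<Rightarrow> real \<Rightarrow> real" where
  "arc_form w a b = (2 * a * b - (a\<^sup>2 + b\<^sup>2) * cos w) / sin w"

text \<open>
  Picone's identity, with the comparison function \<open>sin\<close> whose zero lies at distance \<open>s\<close> before
  the arc: the difference of the two sides is
  \<open>(a * sin (s + w) - b * sin s)\<^sup>2 / (sin w * sin s * sin (s + w))\<close>. The first alternative of the
  hypothesis says that the comparison function has the same sign at both ends of the arc, and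
  then the square is divided by a positive number. The second says that the interpolating
  function is a multiple of the comparison function, and then there is equality; this also covers a zero at an end of the arc,
  where one of the cotangents has the default value \<open>0\<close> and its coefficient vanishes.
\<close>
lemma arc_form_le_cot:
  assumes w: "sin w > 0"
    and ab: "sin s * sin (s + w) > 0 \<or> a * sin (s + w) = b * sin s"
  shows "arc_form w a b \<le> a\<^sup>2 * cot s - b\<^sup>2 * cot (s + w)"
proof -
  have s': "sin (s + w) = sin s * cos w + cos s * sin w"
    and c': "cos (s + w) = cos s * cos w - sin s * sin w"
    by (simp_all add: sin_add cos_add)
  consider "sin s = 0" | "sin s \<noteq> 0" "sin (s + w) = 0" | "sin s \<noteq> 0" "sin (s + w) \<noteq> 0"
    by blast
  then show ?thesis
  proof cases
    case 1
    then have "cos s \<noteq> 0"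
      using sin_zero_abs_cos_one by fastforce
    moreover from this have "a = 0"
      using ab 1 w by (auto simp: s')
    ultimately show ?thesis
      using 1 w by (simp add: arc_form_def cot_def s' c')
  next
    case 2
    then have "b = 0"
      using ab by auto
    moreover have "cos s / sin s = - cos w / sin w"
      using 2 w s' by (simp add: field_simps)
    ultimately show ?thesis
      using w by (simp add: arc_form_def cot_def 2)
  next
    case 3
    have "cos s / sin s + cos w / sin w = sin (s + w) / (sin s * sin w)"
      using 3 w by (simp add: s' field_simps)
    moreover have "cos (s + w) / sin (s + w) - cos w / sin w = - sin s / (sin (s + w) * sin w)"
    proof -
      have "cos (s + w) * sin w - cos w * sin (s + w) = - sin s"
        using sin_diff[of "s + w" w] by (simp add: algebra_simps)
      moreover have "cos (s + w) / sin (s + w) - cos w / sin w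
          = (cos (s + w) * sin w - cos w * sin (s + w)) / (sin (s + w) * sin w)"
        using 3 w by (intro diff_frac_eq) auto
      ultimately show ?thesis by simp
    qed
    ultimately have cots: "cot s = sin (s + w) / (sin s * sin w) - cos w / sin w"
      "cot (s + w) = cos w / sin w - sin s / (sin (s + w) * sin w)"
      by (simp_all add: cot_def)
    have "arc_form w a b - (a\<^sup>2 * cot s - b\<^sup>2 * cot (s + w))
        = - ((a * sin (s + w) - b * sin s)\<^sup>2 / (sin w * (sin s * sin (s + w))))"
      unfolding arc_form_def cots using 3 w
      by (simp add: field_simps power2_eq_square)
    also have "\<dots> \<le> 0"
      using ab w by (auto simp: divide_nonneg_pos)
    finally show ?thesis by simp
  qed
qed

lemma glue_continuous:
  fixes \<tau> :: "nat \<Rightarrow> real" and g :: "nat \<Rightarrow> real \<Rightarrow> real"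
  assumes "\<And>k. k < m \<Longrightarrow> \<tau> k < \<tau> (Suc k)"
    and "\<And>k. k < m \<Longrightarrow> continuous_on {\<tau> k..\<tau> (Suc k)} (g k)"
    and "\<And>k. Suc k < m \<Longrightarrow> g k (\<tau> (Suc k)) = g (Suc k) (\<tau> (Suc k))"
  shows "\<exists>p. continuous_on {\<tau> 0..\<tau> m} p \<and> (\<forall>k<m. \<forall>t\<in>{\<tau> k..\<tau> (Suc k)}. p t = g k t)"
  using assms
proof (induction m)
  case 0
  then show ?case by (auto intro!: exI[of _ "\<lambda>_. 0"])
next
  case (Suc m)
  then obtain p where p: "continuous_on {\<tau> 0..\<tau> m} p"
    and pg: "\<And>k t. k < m \<Longrightarrow> t \<in> {\<tau> k..\<tau> (Suc k)} \<Longrightarrow> p t = g k t"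
    by auto
  have mono: "\<tau> j \<le> \<tau> k" if "j \<le> k" "k \<le> Suc m" for j k
    using that
  proof (induction k rule: dec_induct)
    case (step n)
    then show ?case using Suc.prems(1)[of n] by simp
  qed simp
  define r where "r t = (if t \<le> \<tau> m then (if m = 0 then g 0 t else p t) else g m t)" for t
  have joint: "p (\<tau> m) = g m (\<tau> m)" if "m \<noteq> 0"
  proof -
    from that obtain n where n: "m = Suc n" by (cases m) auto
    have "p (\<tau> m) = g n (\<tau> m)"
      using pg[of n "\<tau> m"] mono[of n m] by (simp add: n)
    then show ?thesis using Suc.prems(3)[of n] by (simp add: n)
  qed
  have eq: "{\<tau> 0..\<tau> (Suc m)} = {\<tau> 0..\<tau> m} \<union> {\<tau> m..\<tau> (Suc m)}"
    using mono[of 0 m] mono[of m "Suc m"] by auto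
  have "continuous_on {\<tau> 0..\<tau> (Suc m)} r"
    unfolding eq r_def
  proof (rule continuous_on_cases)
    show "continuous_on {\<tau> 0..\<tau> m} (\<lambda>t. if m = 0 then g 0 t else p t)"
      using p by (cases "m = 0") auto
    show "continuous_on {\<tau> m..\<tau> (Suc m)} (g m)"
      using Suc.prems(2)[of m] by simp
    show "\<forall>t. t \<in> {\<tau> 0..\<tau> m} \<and> \<not> t \<le> \<tau> m \<or> t \<in> {\<tau> m..\<tau> (Suc m)} \<and> t \<le> \<tau> m \<longrightarrow>
      (if m = 0 then g 0 t else p t) = g m t"
      using joint by (auto simp: order.antisym)
  qed auto
  moreover have "r t = g k t" if "k < Suc m" "t \<in> {\<tau> k..\<tau> (Suc k)}" for k t
  proof (cases "k = m")
    case True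
    then show ?thesis
      using that joint by (auto simp: r_def order.antisym)
  next
    case False
    then show ?thesis
      using that pg[of k t] mono[of "Suc k" m] by (auto simp: r_def)
  qed
  ultimately show ?case by blast
qed

text \<open>
  A closed piecewise trigonometric function with two zeros \<open>u\<close> and \<open>v = u + \<theta>/2\<close> that cut the
  circle of length \<open>\<theta> < 2 * pi\<close> into halves shorter than \<open>pi\<close> has non-positive energy: it is a
  sum of two functions on intervals shorter than \<open>pi\<close> with zero boundary values. A zero may lie
  inside an arc, so the proof does not cut the arcs. Every arc is compared with the sine function
  centred at one zero: at \<open>u\<close> for the arcs before the arc \<open>l\<close> that contains \<open>v\<close>, at \<open>v\<close> for the
  arc \<open>l\<close>, and at \<open>u + \<theta>\<close>, which is the point \<open>u\<close> again, for the later arcs. The bounds telescope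
  to boundary terms at the two ends of the arc \<open>l\<close>, which have the right sign.
\<close>
lemma closed_arc_form_nonpos:
  fixes \<tau> a :: "nat \<Rightarrow> real" and y :: "real \<Rightarrow> real"
  assumes w: "\<And>k. k < m \<Longrightarrow> \<tau> k < \<tau> (Suc k)" "\<And>k. k < m \<Longrightarrow> \<tau> (Suc k) - \<tau> k < pi"
    and \<tau>: "\<tau> 0 = 0" "\<tau> m = \<theta>" "\<theta> < 2 * pi"
    and am: "a m = a 0"
    and y: "\<And>k t. k < m \<Longrightarrow> t \<in> {\<tau> k..\<tau> (Suc k)} \<Longrightarrow>
      y t * sin (\<tau> (Suc k) - \<tau> k) = a k * sin (\<tau> (Suc k) - t) + a (Suc k) * sin (t - \<tau> k)"
    and u: "0 \<le> u" "u \<le> \<theta> / 2" "y u = 0" "y (u + \<theta> / 2) = 0"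
  shows "(\<Sum>k<m. arc_form (\<tau> (Suc k) - \<tau> k) (a k) (a (Suc k))) \<le> 0"
proof (cases "m = 0")
  case False
  define v where "v = u + \<theta> / 2"
  define q where "q k = arc_form (\<tau> (Suc k) - \<tau> k) (a k) (a (Suc k))" for k
  define B where "B c k = (a k)\<^sup>2 * cot (\<tau> k - c)" for c k
  have mono: "\<tau> j \<le> \<tau> k" if "j \<le> k" "k \<le> m" for j k
    using that
  proof (induction k rule: dec_induct)
    case (step n)
    then show ?case using w(1)[of n] by simp
  qed simp
  have smono: "\<tau> j < \<tau> k" if "j < k" "k \<le> m" for j k
    using w(1)[of j] mono[of "Suc j" k] that by simp
  have \<theta>: "0 < \<theta>"
    using smono[of 0 m] False \<tau> by simp
  have sinw: "sin (\<tau> (Suc k) - \<tau> k) > 0" if "k < m" for k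
    using w that by (simp add: sin_gt_zero)
  have node: "y (\<tau> k) = a k \<and> y (\<tau> (Suc k)) = a (Suc k)" if "k < m" for k
    using y[of k "\<tau> k"] y[of k "\<tau> (Suc k)"] sinw[of k] w(1)[of k] that by simp
  have node_le: "y (\<tau> k) = a k" if "k \<le> m" for k
    using node[of k] node[of "m - 1"] that False by (cases "k = m") auto
  have zero: "a k * sin (\<tau> (Suc k) - c) = a (Suc k) * sin (\<tau> k - c)"
    if "k < m" "c \<in> {\<tau> k..\<tau> (Suc k)}" "y c = 0" for k c
  proof -
    have "sin (c - \<tau> k) = - sin (\<tau> k - c)"
      using sin_minus[of "\<tau> k - c"] by simp
    then show ?thesis
      using y[of k c] that by simp
  qed
  have picone: "q k \<le> B c k - B c (Suc k)"
    if "k < m" and "sin (\<tau> k - c) * sin (\<tau> (Suc k) - c) > 0 \<or>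
      a k * sin (\<tau> (Suc k) - c) = a (Suc k) * sin (\<tau> k - c)" for k c
    using arc_form_le_cot[of "\<tau> (Suc k) - \<tau> k" "\<tau> k - c" "a k" "a (Suc k)"] sinw that
    unfolding q_def B_def by (simp add: algebra_simps)
  have sgn: "sin (\<tau> k - c) * sin (\<tau> (Suc k) - c) > 0"
    if "c < \<tau> k \<and> \<tau> (Suc k) - c < pi \<or> \<tau> (Suc k) < c \<and> c - \<tau> k < pi" "k < m" for k c
    using that(1)
  proof
    assume "c < \<tau> k \<and> \<tau> (Suc k) - c < pi"
    then show ?thesis
      using w(1)[OF that(2)] by (intro mult_pos_pos sin_gt_zero) auto
  next
    assume "\<tau> (Suc k) < c \<and> c - \<tau> k < pi"
    then have "sin (c - \<tau> k) * sin (c - \<tau> (Suc k)) > 0"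
      using w(1)[OF that(2)] by (intro mult_pos_pos sin_gt_zero) auto
    then show ?thesis
      using sin_minus[of "\<tau> k - c"] sin_minus[of "\<tau> (Suc k) - c"] by simp
  qed
  have vle: "v \<le> \<theta>" using u v_def by simp
  obtain l where l: "l < m" "\<tau> l \<le> v" "v \<le> \<tau> (Suc l)"
  proof -
    define k where "k = (LEAST k. v \<le> \<tau> k)"
    have k: "v \<le> \<tau> k" unfolding k_def by (rule LeastI[of _ m]) (simp add: \<tau> vle)
    have "k \<le> m" unfolding k_def by (rule Least_le) (simp add: \<tau> vle)
    have "k \<noteq> 0" using k \<tau> u \<theta> v_def by (intro notI) auto
    then obtain l where "k = Suc l" by (cases k) auto
    moreover have "\<not> v \<le> \<tau> l"
      using not_less_Least[of l "\<lambda>k. v \<le> \<tau> k"] \<open>k = Suc l\<close> k_def by simp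
    ultimately show ?thesis using that[of l] k \<open>k \<le> m\<close> by simp
  qed
  have half: "v - u = \<theta> / 2" "\<theta> / 2 < pi" "0 < \<theta> / 2"
    using \<tau> \<theta> v_def by auto
  have 1: "(\<Sum>k<l. q k) \<le> B u 0 - B u l"
  proof -
    have "q k \<le> B u k - B u (Suc k)" if "k < l" for k
    proof (rule picone)
      have k: "\<tau> (Suc k) \<le> v" "0 \<le> \<tau> k" "k < m"
        using mono[of "Suc k" l] mono[of 0 k] \<tau> that l by auto
      show "sin (\<tau> k - u) * sin (\<tau> (Suc k) - u) > 0 \<or>
          a k * sin (\<tau> (Suc k) - u) = a (Suc k) * sin (\<tau> k - u)"
      proof (cases "u \<in> {\<tau> k..\<tau> (Suc k)}")
        case True
        then show ?thesis using zero[of k u] k u by simp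
      next
        case False
        then have "u < \<tau> k \<and> \<tau> (Suc k) - u < pi \<or> \<tau> (Suc k) < u \<and> u - \<tau> k < pi"
          using k u half by (auto simp: not_le)
        then show ?thesis using k by (intro disjI1) (rule sgn)
      qed
    qed (use that l in simp)
    then have "(\<Sum>k<l. q k) \<le> (\<Sum>k<l. B u k - B u (Suc k))"
      by (intro sum_mono) simp
    then show ?thesis by (simp add: sum_lessThan_telescope')
  qed
  have 2: "q l \<le> B v l - B v (Suc l)"
    using l u zero[of l v] by (intro picone) (auto simp: v_def)
  have 3: "(\<Sum>k=Suc l..<m. q k) \<le> B (u + \<theta>) (Suc l) - B (u + \<theta>) m"
  proof -
    have "q k \<le> - (B (u + \<theta>) (Suc k) - B (u + \<theta>) k)" if "Suc l \<le> k" "k < m" for k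
    proof -
      have k: "v \<le> \<tau> k" "\<tau> (Suc k) \<le> \<theta>"
        using mono[of "Suc l" k] mono[of "Suc k" m] \<tau> that l by auto
      have "q k \<le> B (u + \<theta>) k - B (u + \<theta>) (Suc k)"
      proof (rule picone)
        show "sin (\<tau> k - (u + \<theta>)) * sin (\<tau> (Suc k) - (u + \<theta>)) > 0 \<or>
          a k * sin (\<tau> (Suc k) - (u + \<theta>)) = a (Suc k) * sin (\<tau> k - (u + \<theta>))"
        proof (cases "\<tau> (Suc k) < u + \<theta>")
          case True
          then have "\<tau> (Suc k) < u + \<theta> \<and> u + \<theta> - \<tau> k < pi"
            using k(1) half by linarith
          then show ?thesis using that by (intro disjI1) (rule sgn, auto)
        next
          case False
          then have "u = 0" "\<tau> (Suc k) = \<theta>" using k u by auto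
          then have "Suc k = m"
            using smono[of "Suc k" m] \<tau> that by (cases "Suc k < m") auto
          then have "a (Suc k) = 0"
            using node_le[of 0] u \<tau> am \<open>u = 0\<close> by simp
          then show ?thesis using \<open>u = 0\<close> \<open>\<tau> (Suc k) = \<theta>\<close> by simp
        qed
      qed (use that in simp)
      then show ?thesis by simp
    qed
    then have "(\<Sum>k=Suc l..<m. q k) \<le> (\<Sum>k=Suc l..<m. - (B (u + \<theta>) (Suc k) - B (u + \<theta>) k))"
      by (intro sum_mono) simp
    also have "\<dots> = - (B (u + \<theta>) m - B (u + \<theta>) (Suc l))"
      unfolding sum_negf using l by (subst sum_Suc_diff') auto
    finally show ?thesis by simp
  qed
  have 4: "B (u + \<theta>) m = B u 0"
    by (simp add: B_def am \<tau>)
  have cots: "cot x + cot z \<ge> 0" if "0 < x" "0 < z" "x + z < pi" for x z :: real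
  proof -
    have "sin x > 0" "sin z > 0" "sin (x + z) > 0"
      using that by (auto intro!: sin_gt_zero)
    then have "sin (x + z) / (sin x * sin z) \<ge> 0" by simp
    then show ?thesis
      using \<open>sin x > 0\<close> \<open>sin z > 0\<close> by (simp add: sin_add cot_def field_simps)
  qed
  have 5: "B v l - B u l \<le> 0"
  proof (cases "a l = 0")
    case False
    have ne: "\<tau> l \<noteq> v" "\<tau> l \<noteq> u"
      using node[of l] l u False v_def by auto
    \<comment> \<open>Otherwise both zeros lie on the arc \<open>l\<close>, at distance less than \<open>pi\<close>, so the function vanishes on it.\<close>
    have "u < \<tau> l"
    proof (rule ccontr)
      assume "\<not> ?thesis"
      then have ul: "u \<in> {\<tau> l..\<tau> (Suc l)}"
        using l half by auto
      have e1: "a l * sin (\<tau> (Suc l) - u) = a (Suc l) * sin (\<tau> l - u)"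
        using zero[OF l(1) ul] u by simp
      have e2: "a l * sin (\<tau> (Suc l) - v) = a (Suc l) * sin (\<tau> l - v)"
        using zero[OF l(1), of v] l u by (simp add: v_def)
      have "a l * (sin (\<tau> (Suc l) - u) * sin (\<tau> l - v) - sin (\<tau> (Suc l) - v) * sin (\<tau> l - u)) = 0"
        using e1 e2 by algebra
      moreover have "sin (\<tau> (Suc l) - u) * sin (\<tau> l - v) - sin (\<tau> (Suc l) - v) * sin (\<tau> l - u)
          = - (sin (\<tau> (Suc l) - \<tau> l) * sin (v - u))"
      proof -
        have id: "sin (x - s) * sin (z - r) - sin (x - r) * sin (z - s) = - (sin (x - z) * sin (r - s))"
          for x z r s :: real
          using cos_minus[of "s + x - (r + z)"]
          by (simp add: sin_times_sin algebra_simps add_divide_distrib diff_divide_distrib)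
        show ?thesis by (rule id)
      qed
      moreover have "sin (v - u) > 0"
        unfolding half using half by (intro sin_gt_zero) auto
      ultimately show False
        using False sinw[OF l(1)] by auto
    qed
    then have "cot (\<tau> l - u) + cot (v - \<tau> l) \<ge> 0"
      using ne l half by (intro cots) auto
    moreover have "B v l - B u l = - ((a l)\<^sup>2 * (cot (\<tau> l - u) + cot (v - \<tau> l)))"
      unfolding B_def using cot_minus[of "v - \<tau> l"] by (simp add: algebra_simps)
    ultimately show ?thesis by simp
  qed (simp add: B_def)
  have 6: "B (u + \<theta>) (Suc l) - B v (Suc l) \<le> 0"
  proof (cases "a (Suc l) = 0")
    case False
    have "\<tau> (Suc l) \<noteq> v"
      using node[of l] l u False v_def by auto
    moreover have "\<tau> (Suc l) \<noteq> u + \<theta>"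
    proof
      assume c: "\<tau> (Suc l) = u + \<theta>"
      have "\<tau> (Suc l) \<le> \<theta>" using mono[of "Suc l" m] l \<tau> by simp
      then have "u = 0" "\<tau> (Suc l) = \<theta>" using c u by auto
      then have "Suc l = m"
        using smono[of "Suc l" m] \<tau> l by (cases "Suc l < m") auto
      then have "a (Suc l) = 0"
        using node_le[of 0] u \<tau> am \<open>u = 0\<close> by simp
      then show False using False by simp
    qed
    moreover have "\<tau> (Suc l) \<le> \<theta>" using mono[of "Suc l" m] l \<tau> by simp
    ultimately have "cot (\<tau> (Suc l) - v) + cot (u + \<theta> - \<tau> (Suc l)) \<ge> 0"
      using l half u by (intro cots) auto
    moreover have "B (u + \<theta>) (Suc l) - B v (Suc l)
        = - ((a (Suc l))\<^sup>2 * (cot (\<tau> (Suc l) - v) + cot (u + \<theta> - \<tau> (Suc l))))"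
      unfolding B_def using cot_minus[of "u + \<theta> - \<tau> (Suc l)"] by (simp add: algebra_simps)
    ultimately show ?thesis by simp
  qed (simp add: B_def)
  have "(\<Sum>k<m. q k) = (\<Sum>k<l. q k) + q l + (\<Sum>k=Suc l..<m. q k)"
  proof -
    have "{..<m} = {..<l} \<union> {l} \<union> {Suc l..<m}"
      using l by auto
    also have "sum q \<dots> = (\<Sum>k<l. q k) + q l + (\<Sum>k=Suc l..<m. q k)"
      by (subst sum.union_disjoint; auto)+
    finally show ?thesis .
  qed
  then show ?thesis
    using 1 2 3 4 5 6 unfolding q_def by linarith
qed simp

text \<open>
  Let \<open>p\<close> and \<open>q\<close> be the piecewise trigonometric functions through the values \<open>a\<close> and \<open>b\<close>. The
  function \<open>W t = p t * q (t + \<theta>/2) - q t * p (t + \<theta>/2)\<close> changes its sign under a half turn, so it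
  vanishes at some \<open>u\<close>. Then the vectors \<open>(p, q)\<close> at \<open>u\<close> and at \<open>u + \<theta>/2\<close> are linearly dependent,
  and some nontrivial combination of \<open>p\<close> and \<open>q\<close> vanishes at both points. Hence the energy cannot be
  positive definite on a plane.
\<close>
lemma nonpos_combination_exists:
  fixes \<omega> a b :: "nat \<Rightarrow> real"
  assumes \<omega>: "\<And>k. k < m \<Longrightarrow> 0 < \<omega> k" "\<And>k. k < m \<Longrightarrow> \<omega> k < pi"
    and \<theta>: "(\<Sum>k<m. \<omega> k) < 2 * pi"
    and per: "a m = a 0" "b m = b 0"
  shows "\<exists>r s. (r \<noteq> 0 \<or> s \<noteq> 0) \<and>
    (\<Sum>k<m. arc_form (\<omega> k) (r * a k + s * b k) (r * a (Suc k) + s * b (Suc k))) \<le> 0"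
proof -
  define \<tau> where "\<tau> k = (\<Sum>j<k. \<omega> j)" for k
  define \<theta>' where "\<theta>' = \<tau> m"
  have \<tau>: "\<tau> (Suc k) - \<tau> k = \<omega> k" "\<tau> (Suc k) = \<tau> k + \<omega> k" for k
    by (simp_all add: \<tau>_def)
  have sin: "sin (\<omega> k) > 0" if "k < m" for k
    using \<omega> that by (simp add: sin_gt_zero)
  have interp: "\<exists>p. continuous_on {\<tau> 0..\<tau> m} p \<and> (\<forall>k<m. \<forall>t\<in>{\<tau> k..\<tau> (Suc k)}.
      p t = (c k * sin (\<tau> (Suc k) - t) + c (Suc k) * sin (t - \<tau> k)) / sin (\<omega> k))"
    for c :: "nat \<Rightarrow> real"
  proof (rule glue_continuous)
    fix k assume k: "k < m"
    show "\<tau> k < \<tau> (Suc k)" using \<omega>(1)[OF k] by (simp add: \<tau>)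
    show "continuous_on {\<tau> k..\<tau> (Suc k)}
        (\<lambda>t. (c k * sin (\<tau> (Suc k) - t) + c (Suc k) * sin (t - \<tau> k)) / sin (\<omega> k))"
      using sin[OF k] by (intro continuous_intros) auto
  next
    fix k assume "Suc k < m"
    then have "sin (\<omega> k) > 0" "sin (\<omega> (Suc k)) > 0" using sin[of k] sin[of "Suc k"] by auto
    then show "(c k * sin (\<tau> (Suc k) - \<tau> (Suc k)) + c (Suc k) * sin (\<tau> (Suc k) - \<tau> k)) / sin (\<omega> k)
        = (c (Suc k) * sin (\<tau> (Suc (Suc k)) - \<tau> (Suc k))
          + c (Suc (Suc k)) * sin (\<tau> (Suc k) - \<tau> (Suc k))) / sin (\<omega> (Suc k))"
      by (simp add: \<tau>)
  qed
  obtain p where p: "continuous_on {\<tau> 0..\<tau> m} p"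
    and pa: "\<forall>k<m. \<forall>t\<in>{\<tau> k..\<tau> (Suc k)}.
      p t = (a k * sin (\<tau> (Suc k) - t) + a (Suc k) * sin (t - \<tau> k)) / sin (\<omega> k)"
    using interp[of a] by blast
  obtain q where q: "continuous_on {\<tau> 0..\<tau> m} q"
    and qb: "\<forall>k<m. \<forall>t\<in>{\<tau> k..\<tau> (Suc k)}.
      q t = (b k * sin (\<tau> (Suc k) - t) + b (Suc k) * sin (t - \<tau> k)) / sin (\<omega> k)"
    using interp[of b] by blast
  have \<tau>0: "\<tau> 0 = 0" by (simp add: \<tau>_def)
  show ?thesis
  proof (cases "m = 0")
    case True
    then show ?thesis by (auto intro!: exI[of _ 1])
  next
    case False
    then obtain n where n: "m = Suc n" by (cases m) auto
    have \<theta>0: "0 < \<theta>'"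
      unfolding \<theta>'_def \<tau>_def using False \<omega> by (intro sum_pos) auto
    have ends: "p \<theta>' = p 0" "q \<theta>' = q 0"
    proof -
      have "p 0 = a 0" "q 0 = b 0"
        using pa[rule_format, of 0 0] qb[rule_format, of 0 0] False sin[of 0] \<omega>[of 0]
        by (simp_all add: \<tau> \<tau>0)
      moreover have "p \<theta>' = a m" "q \<theta>' = b m"
        using pa[rule_format, of n \<theta>'] qb[rule_format, of n \<theta>'] sin[of n] \<omega>[of n]
        by (simp_all add: \<theta>'_def \<tau> n)
      ultimately show "p \<theta>' = p 0" "q \<theta>' = q 0"
        using per by simp_all
    qed
    define W where "W t = p t * q (t + \<theta>' / 2) - q t * p (t + \<theta>' / 2)" for t
    have "continuous_on {0..\<theta>' / 2} W"
    proof -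
      have sub: "{0..\<theta>' / 2} \<subseteq> {\<tau> 0..\<tau> m}" "(\<lambda>t. t + \<theta>' / 2) ` {0..\<theta>' / 2} \<subseteq> {\<tau> 0..\<tau> m}"
        using \<theta>0 by (auto simp: \<tau>0 \<theta>'_def[symmetric])
      have "continuous_on {0..\<theta>' / 2} (\<lambda>t. t + \<theta>' / 2)" by (intro continuous_intros)
      note shift = continuous_on_compose2[OF _ this sub(2)]
      show ?thesis
        unfolding W_def
        by (intro continuous_on_diff continuous_on_mult shift[OF p] shift[OF q]
            continuous_on_subset[OF p sub(1)] continuous_on_subset[OF q sub(1)])
    qed
    moreover have "W (\<theta>' / 2) = - W 0"
      unfolding W_def using ends by simp
    ultimately obtain u where u: "0 \<le> u" "u \<le> \<theta>' / 2" "W u = 0"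
      using IVT'[of W 0 0 "\<theta>' / 2"] IVT2'[of W "\<theta>' / 2" 0 0] \<theta>0
      by (cases "W 0 \<le> 0") force+
    obtain r s where rs: "r \<noteq> 0 \<or> s \<noteq> 0" "r * p u + s * q u = 0"
      "r * p (u + \<theta>' / 2) + s * q (u + \<theta>' / 2) = 0"
    proof -
      let ?v = "u + \<theta>' / 2"
      consider "p u \<noteq> 0 \<or> q u \<noteq> 0" | "p u = 0" "q u = 0" "p ?v \<noteq> 0 \<or> q ?v \<noteq> 0"
        | "p u = 0" "q u = 0" "p ?v = 0" "q ?v = 0" by blast
      then show ?thesis
      proof cases
        case 1
        then show ?thesis using that[of "q u" "- p u"] u(3) by (auto simp: W_def algebra_simps)
      next
        case 2
        then show ?thesis using that[of "q ?v" "- p ?v"] by (auto simp: algebra_simps)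
      next
        case 3
        then show ?thesis using that[of 1 0] by simp
      qed
    qed
    have "(\<Sum>k<m. arc_form (\<tau> (Suc k) - \<tau> k) (r * a k + s * b k)
        (r * a (Suc k) + s * b (Suc k))) \<le> 0"
    proof (rule closed_arc_form_nonpos[where \<tau> = \<tau> and \<theta> = \<theta>' and u = u
          and y = "\<lambda>t. r * p t + s * q t" and a = "\<lambda>k. r * a k + s * b k"])
      fix k t assume k: "k < m" and t: "t \<in> {\<tau> k..\<tau> (Suc k)}"
      show "(r * p t + s * q t) * sin (\<tau> (Suc k) - \<tau> k) =
          (r * a k + s * b k) * sin (\<tau> (Suc k) - t) +
          (r * a (Suc k) + s * b (Suc k)) * sin (t - \<tau> k)"
        using pa[rule_format, OF k t] qb[rule_format, OF k t] sin[OF k]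
        by (simp add: \<tau>(1)) (simp add: field_simps)
    qed (use \<omega> \<theta> per u rs \<tau>0 in \<open>simp_all add: \<tau> \<theta>'_def \<tau>_def[symmetric]\<close>)
    then show ?thesis
      using rs(1) by (auto simp: \<tau>(1))
  qed
qed


section \<open>The energy form of a cone with angle less than \<open>2\<pi>\<close>\<close>

text \<open>
  A function on the rays \<open>e\<close> of a cone, cyclically ordered by \<open>c\<close> with angle \<open>\<omega> e\<close> between \<open>e\<close> and
  \<open>c e\<close>, extends trigonometrically to the circle of directions; \<open>slope_jump\<close> is the jump of the
  derivative of the extension at \<open>e\<close>. For the altitudes of the sides of a polygon this is the
  length of the side \<open>e\<close>, and \<open>cone_form\<close> is twice the mixed area.
\<close>
definition slope_jump :: "('e \<Rightarrow> 'e) \<Rightarrow> ('e \<Rightarrow> real) \<Rightarrow> ('e \<Rightarrow> real) \<Rightarrow> 'e \<Rightarrow> real" where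
  "slope_jump c \<omega> f e =
     (f (c e) - f e * cos (\<omega> e)) / sin (\<omega> e) +
     (f (inv c e) - f e * cos (\<omega> (inv c e))) / sin (\<omega> (inv c e))"

definition cone_form ::
  "('e \<Rightarrow> 'e) \<Rightarrow> ('e \<Rightarrow> real) \<Rightarrow> 'e set \<Rightarrow> ('e \<Rightarrow> real) \<Rightarrow> ('e \<Rightarrow> real) \<Rightarrow> real" where
  "cone_form c \<omega> S f g = (\<Sum>e\<in>S. f e * slope_jump c \<omega> g e)"

lemma slope_jump_lin:
  "slope_jump c \<omega> (\<lambda>e. r * f e + s * g e) e = r * slope_jump c \<omega> f e + s * slope_jump c \<omega> g e"
  by (simp add: slope_jump_def add_divide_distrib diff_divide_distrib algebra_simps)

lemma cone_form_lin_right: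
  "cone_form c \<omega> S f (\<lambda>e. r * g e + s * h e) = r * cone_form c \<omega> S f g + s * cone_form c \<omega> S f h"
  by (simp add: cone_form_def slope_jump_lin sum_distrib_left sum.distrib algebra_simps)

text \<open>
  Summation by parts: the part of the jump at \<open>c e\<close> that comes from the arc between \<open>e\<close> and \<open>c e\<close>
  is moved to \<open>e\<close>. The form becomes a sum over arcs, which is visibly symmetric and is the
  polarization of \<open>arc_form\<close>.
\<close>
lemma cone_form_eq_arcs:
  assumes "bij c" "c ` S = S"
  shows "cone_form c \<omega> S f g =
    (\<Sum>e\<in>S. (f e * g (c e) + f (c e) * g e - (f e * g e + f (c e) * g (c e)) * cos (\<omega> e)) / sin (\<omega> e))"
proof -
  have inv: "inv c (c e) = e" for e
    using assms(1) by (simp add: bij_is_inj)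
  have "(\<Sum>e\<in>S. f e * ((g (inv c e) - g e * cos (\<omega> (inv c e))) / sin (\<omega> (inv c e))))
      = (\<Sum>e\<in>S. f (c e) * ((g e - g (c e) * cos (\<omega> e)) / sin (\<omega> e)))"
  proof -
    have "bij_betw c S S"
      using assms by (auto simp: bij_betw_def bij_is_inj intro: inj_on_subset)
    then show ?thesis
      by (subst sum.reindex_bij_betw[of c S S, symmetric]) (auto simp: inv)
  qed
  then show ?thesis
    unfolding cone_form_def slope_jump_def distrib_left sum.distrib
    by (simp flip: sum.distrib add: add_divide_distrib[symmetric] algebra_simps)
qed

lemma cone_form_commute:
  assumes "bij c" "c ` S = S"
  shows "cone_form c \<omega> S f g = cone_form c \<omega> S g f"
  unfolding cone_form_eq_arcs[OF assms] by (simp add: algebra_simps)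

lemma cone_form_lin_left:
  assumes "bij c" "c ` S = S"
  shows "cone_form c \<omega> S (\<lambda>e. r * g e + s * h e) f = r * cone_form c \<omega> S g f + s * cone_form c \<omega> S h f"
  using cone_form_lin_right[of c \<omega> S f r g s h] cone_form_commute[OF assms] by metis

lemma orbit_enum:
  fixes c :: "'e::finite \<Rightarrow> 'e"
  assumes "bij c"
  obtains m where "0 < m" "(c ^^ m) x = x" "bij_betw (\<lambda>k. (c ^^ k) x) {..<m} (orbit c x)"
proof -
  have "x \<in> orbit c x"
    using assms by (intro permutation_self_in_orbit) (simp add: permutation)
  then show ?thesis
    using that[of "funpow_dist1 c x x"] funpow_dist1_prop[of x c x] inj_on_funpow_dist1[of x c x]
      orbit_conv_funpow_dist1[of x c]
    by (simp add: bij_betw_def atLeast0LessThan)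
qed

lemma image_orbit:
  fixes c :: "'e::finite \<Rightarrow> 'e"
  assumes "bij c"
  shows "c ` orbit c x = orbit c x"
proof (rule card_subset_eq)
  show "c ` orbit c x \<subseteq> orbit c x" by (auto intro: orbit.step)
  show "card (c ` orbit c x) = card (orbit c x)"
    using bij_is_inj[OF assms] by (intro card_image) (rule inj_on_subset, auto)
qed simp

locale cone_angles =
  fixes c :: "'e::finite \<Rightarrow> 'e" and \<omega> :: "'e \<Rightarrow> real" and x :: 'e
  assumes bij: "bij c"
    and \<omega>: "\<And>e. 0 < \<omega> e" "\<And>e. \<omega> e < pi"
    and total: "(\<Sum>e\<in>orbit c x. \<omega> e) < 2 * pi"
begin

abbreviation "S \<equiv> orbit c x"
abbreviation "Q \<equiv> cone_form c \<omega> S"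

lemmas Q_commute = cone_form_commute[OF bij image_orbit[OF bij], of \<omega> x]
  and Q_lin_left = cone_form_lin_left[OF bij image_orbit[OF bij], of \<omega> x]
  and Q_lin_right = cone_form_lin_right[of c \<omega> S]

text \<open>
  With \<open>Q f f > 0\<close> and \<open>Q g g > 0\<close>, the form would be positive definite on the plane spanned by \<open>f\<close>
  and \<open>g\<close>.
\<close>
lemma nonpos_on_orthogonal:
  assumes "Q f f > 0" "Q f g = 0"
  shows "Q g g \<le> 0"
proof -
  obtain m where m: "0 < m" "(c ^^ m) x = x" "bij_betw (\<lambda>k. (c ^^ k) x) {..<m} S"
    using orbit_enum[OF bij] by blast
  note sum = sum.reindex_bij_betw[OF m(3)]
  obtain r s where rs: "r \<noteq> 0 \<or> s \<noteq> 0"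
    and le: "(\<Sum>k<m. arc_form (\<omega> ((c ^^ k) x)) (r * f ((c ^^ k) x) + s * g ((c ^^ k) x))
      (r * f ((c ^^ Suc k) x) + s * g ((c ^^ Suc k) x))) \<le> 0"
    using nonpos_combination_exists[of m "\<lambda>k. \<omega> ((c ^^ k) x)" "\<lambda>k. f ((c ^^ k) x)" "\<lambda>k. g ((c ^^ k) x)"]
      \<omega> total m(2) by (auto simp: sum)
  let ?y = "\<lambda>e. r * f e + s * g e"
  have "Q ?y ?y = (\<Sum>e\<in>S. arc_form (\<omega> e) (?y e) (?y (c e)))"
    unfolding cone_form_eq_arcs[OF bij image_orbit[OF bij]] arc_form_def
    by (intro sum.cong refl arg_cong2[where f = "(/)"]) (simp add: power2_eq_square algebra_simps)
  also have "\<dots> \<le> 0"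
    using le sum[of "\<lambda>e. arc_form (\<omega> e) (?y e) (?y (c e))"] by simp
  finally have "Q ?y ?y \<le> 0" .
  moreover have "Q ?y ?y = r\<^sup>2 * Q f f + s\<^sup>2 * Q g g"
    using assms Q_commute[of g f]
    by (simp add: Q_lin_left Q_lin_right power2_eq_square algebra_simps)
  ultimately have *: "r\<^sup>2 * Q f f + s\<^sup>2 * Q g g \<le> 0" by simp
  have "s \<noteq> 0"
    using * rs assms(1) by (auto simp: mult_le_0_iff)
  show ?thesis
  proof (rule ccontr)
    assume "\<not> ?thesis"
    then have "s\<^sup>2 * Q g g > 0" using \<open>s \<noteq> 0\<close> by simp
    moreover have "r\<^sup>2 * Q f f \<ge> 0" using assms(1) by simp
    ultimately show False using * by simp
  qed
qed

text \<open>
  Without jumps the extension of \<open>g\<close> is trigonometric all around the circle. Its value and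
  derivative, combined to the complex number \<open>z\<close>, are rotated by the total angle on the way around,
  and a rotation by an angle strictly between \<open>0\<close> and \<open>2\<pi>\<close> fixes only \<open>0\<close>.
\<close>
lemma straight_imp_zero:
  assumes "\<And>e. e \<in> S \<Longrightarrow> slope_jump c \<omega> g e = 0" and "e \<in> S"
  shows "g e = 0"
proof -
  obtain m where m: "0 < m" "(c ^^ m) x = x" "bij_betw (\<lambda>k. (c ^^ k) x) {..<m} S"
    using orbit_enum[OF bij] by blast
  define w where "w k = \<omega> ((c ^^ k) x)" for k
  define a where "a k = g ((c ^^ k) x)" for k
  \<comment> \<open>The imaginary part is the one-sided derivative at the ray \<open>k\<close>, into the arc that follows it.\<close>
  define z where "z k = Complex (a k) ((a (Suc k) - a k * cos (w k)) / sin (w k))" for k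
  have sin: "sin (w k) > 0" for k
    using \<omega> by (simp add: w_def sin_gt_zero)
  have step: "z (Suc k) = z k * cis (- w k)" for k
  proof -
    have "(c ^^ Suc k) x \<in> S"
      by (simp add: orbit_altdef) (metis funpow.simps(2) o_apply zero_less_Suc)
    moreover have "inv c (c y) = y" for y
      using bij by (simp add: bij_is_inj)
    ultimately have "(a (Suc (Suc k)) - a (Suc k) * cos (w (Suc k))) / sin (w (Suc k))
        = - ((a k - a (Suc k) * cos (w k)) / sin (w k))"
      using assms(1)[of "(c ^^ Suc k) x"] by (simp add: slope_jump_def a_def w_def)
    also have "\<dots> = (a (Suc k) - a k * cos (w k)) / sin (w k) * cos (w k) - a k * sin (w k)"
    proof -
      have "- (a k - a (Suc k) * cos (w k))
          = (a (Suc k) - a k * cos (w k)) * cos (w k) - a k * sin (w k) * sin (w k)"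
        using sin_cos_squared_add[of "w k"] by algebra
      then have "- (a k - a (Suc k) * cos (w k)) / sin (w k)
          = ((a (Suc k) - a k * cos (w k)) * cos (w k) - a k * sin (w k) * sin (w k)) / sin (w k)"
        by simp
      moreover have "(y * r - u * s * s) / s = y / s * r - u * s" if "s > 0" for y r u s :: real
        using that by (simp add: diff_divide_distrib)
      ultimately show ?thesis
        unfolding minus_divide_left using sin[of k] by simp
    qed
    finally show ?thesis
      using sin[of k] by (simp add: z_def complex_eq_iff)
  qed
  have z: "z k = z 0 * cis (- (\<Sum>j<k. w j))" for k
  proof (induction k)
    case (Suc k)
    then show ?case by (simp add: step cis_mult algebra_simps)
  qed simp
  define \<theta> where "\<theta> = (\<Sum>j<m. w j)"
  have \<theta>: "0 < \<theta>" "\<theta> < 2 * pi"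
  proof -
    show "0 < \<theta>"
      unfolding \<theta>_def w_def using m(1) \<omega> by (intro sum_pos) auto
    show "\<theta> < 2 * pi"
      using total sum.reindex_bij_betw[OF m(3), of \<omega>] by (simp add: \<theta>_def w_def)
  qed
  have "z m = z 0"
    using m(2) by (simp add: z_def a_def w_def)
  then have "z 0 * (cis (- \<theta>) - 1) = 0"
    using z[of m] by (simp add: \<theta>_def algebra_simps)
  moreover have "cis (- \<theta>) \<noteq> 1"
  proof
    assume "cis (- \<theta>) = 1"
    then have "cos (2 * (\<theta> / 2)) = 1" by (simp add: complex_eq_iff)
    then have "sin (\<theta> / 2) = 0" unfolding cos_double_sin by simp
    then show False using sin_gt_zero[of "\<theta> / 2"] \<theta> by simp
  qed
  ultimately have "z k = 0" for k
    using z[of k] by simp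
  then have "a k = 0" for k
    by (simp add: z_def complex_eq_iff)
  moreover obtain k where "e = (c ^^ k) x"
    using assms(2) m(3) by (auto simp: bij_betw_def)
  ultimately show ?thesis by (simp add: a_def)
qed

text \<open>
  The form is negative semidefinite on the orthogonal complement of \<open>f\<close>, so a null vector \<open>g\<close> of this
  complement is orthogonal to the complement, hence to everything. Testing with indicator functions
  shows that \<open>g\<close> has no jumps.
\<close>
lemma definite_on_orthogonal:
  assumes f: "Q f f > 0" and g: "Q f g = 0" "Q g g = 0" and "e \<in> S"
  shows "g e = 0"
proof -
  have orth: "Q g z = 0" if z: "Q f z = 0" for z
  proof -
    \<comment> \<open>If \<open>Q g z\<close> were not zero, a small step from \<open>g\<close> towards \<open>z\<close> would make the form positive.\<close>
    define n where "n = 1 + \<bar>Q z z\<bar>"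
    define t where "t = Q g z / n"
    have n: "n > 0" and gz: "Q g z = t * n" by (auto simp: t_def n_def)
    let ?y = "\<lambda>e. 1 * g e + t * z e"
    have "Q f ?y = 0"
      unfolding Q_lin_right using z g by simp
    then have "Q ?y ?y \<le> 0"
      using nonpos_on_orthogonal f by blast
    then have "2 * t * Q g z + t * t * Q z z \<le> 0"
      unfolding Q_lin_right Q_lin_left using g Q_commute[of z g] by (simp add: algebra_simps)
    then have "t\<^sup>2 * (2 * n + Q z z) \<le> 0"
      by (simp add: gz power2_eq_square algebra_simps)
    moreover have "2 * n + Q z z > 0" unfolding n_def by (simp add: abs_if)
    ultimately have "t = 0" by (auto simp: mult_le_0_iff)
    then show ?thesis by (simp add: gz)
  qed
  have ker: "Q g v = 0" for v
  proof -
    let ?r = "Q f v / Q f f"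
    \<comment> \<open>The projection of \<open>v\<close> to the complement of \<open>f\<close>.\<close>
    let ?z = "\<lambda>e. 1 * v e + (- ?r) * f e"
    have "Q f ?z = 0" unfolding Q_lin_right using f by simp
    then have "Q g ?z = 0" by (rule orth)
    then show ?thesis
      unfolding Q_lin_right using g Q_commute[of g f] by simp
  qed
  have "slope_jump c \<omega> g y = 0" if "y \<in> S" for y
  proof -
    have "Q (\<lambda>e. if e = y then 1 else 0) g = slope_jump c \<omega> g y"
      using that by (simp add: cone_form_def if_distrib[where f = "\<lambda>t. t * _"] cong: if_cong)
    then show ?thesis using ker Q_commute by metis
  qed
  then show ?thesis using straight_imp_zero \<open>e \<in> S\<close> by blast
qed

end


section \<open>Spherical triangles\<close>

text \<open>
  The Gram determinant of three unit vectors with mutual distances \<open>a\<close>, \<open>b\<close>, \<open>c\<close>.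
\<close>
definition gram :: "real \<Rightarrow> real \<Rightarrow> real \<Rightarrow> real" where
  "gram a b c = 1 - (cos a)\<^sup>2 - (cos b)\<^sup>2 - (cos c)\<^sup>2 + 2 * cos a * cos b * cos c"

text \<open>
  The Gram determinant is the defect in the Cauchy-Schwarz inequality for the two tangent vectors at
  \<open>x\<close>. Equality would put \<open>z\<close> into the span of \<open>x\<close> and \<open>y\<close>.
\<close>

lemma gram_pos:
  assumes "has_sides x y z a b c" "sin a > 0"
  shows "gram a b c > 0"
proof -
  have n: "norm x = 1" "norm y = 1" "norm z = 1" and d: "distinct [x, y, z]"
    and ind: "independent {x, y, z}"
    and a: "a = sph_dist x y" and b: "b = sph_dist x z" and c: "c = sph_dist y z"
    using assms by (auto simp: has_sides_def spherical_triangle_def)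
  have i: "x \<bullet> x = 1" "y \<bullet> y = 1" "z \<bullet> z = 1"
    using n by (simp_all add: norm_eq_1)
  have cosd: "cos (sph_dist u v) = u \<bullet> v" if "norm u = 1" "norm v = 1" for u v
    using Cauchy_Schwarz_ineq2[of u v] that by (simp add: sph_dist_def cos_arccos_abs)
  let ?v = "sph_dir x y" and ?w = "sph_dir x z"
  have v: "norm ?v > 0" using norm_sph_dir[of x y] n a assms(2) by simp
  have "\<bar>?v \<bullet> ?w\<bar> \<noteq> norm ?v * norm ?w"
  proof
    assume "\<bar>?v \<bullet> ?w\<bar> = norm ?v * norm ?w"
    then have "norm ?v *\<^sub>R ?w = norm ?w *\<^sub>R ?v \<or> norm ?v *\<^sub>R ?w = - norm ?w *\<^sub>R ?v"
      unfolding norm_cauchy_schwarz_abs_eq .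
    then obtain r where r: "norm ?v *\<^sub>R ?w = r *\<^sub>R ?v" by blast
    have "?w = (1 / norm ?v) *\<^sub>R (norm ?v *\<^sub>R ?w)" using v by simp
    then have "?w = (r / norm ?v) *\<^sub>R ?v" unfolding r by simp
    then have "z = (r / norm ?v) *\<^sub>R ?v + (x \<bullet> z) *\<^sub>R x"
      by (simp add: sph_dir_def diff_eq_eq)
    also have "\<dots> \<in> span {x, y}"
      unfolding sph_dir_def by (intro span_add span_diff span_scale span_base) auto
    finally have "z \<in> span ({x, y, z} - {z})"
      using d by (simp add: insert_Diff_if insert_commute)
    then show False using ind by (auto simp: dependent_def)
  qed
  then have "\<bar>?v \<bullet> ?w\<bar> < norm ?v * norm ?w"
    using Cauchy_Schwarz_ineq2[of ?v ?w] by simp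
  then have "(?v \<bullet> ?w)\<^sup>2 < (norm ?v * norm ?w)\<^sup>2"
    by (metis abs_ge_zero power2_abs power_strict_mono zero_less_numeral)
  then have "(?v \<bullet> ?w)\<^sup>2 < (?v \<bullet> ?v) * (?w \<bullet> ?w)"
    by (simp add: power_mult_distrib power2_norm_eq_inner)
  moreover have "(?v \<bullet> ?v) * (?w \<bullet> ?w) - (?v \<bullet> ?w)\<^sup>2 = gram a b c"
    unfolding gram_def a b c cosd[OF n(1,2)] cosd[OF n(1,3)] cosd[OF n(2,3)] sph_dir_def
    by (simp add: inner_diff_left inner_diff_right i inner_commute power2_eq_square algebra_simps)
  ultimately show ?thesis by simp
qed

lemma angle_of_sides:
  assumes s: "has_sides x y z a b c" and a: "0 < a" "a < pi" and b: "0 < b" "b < pi"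
  defines "w \<equiv> angle_of_sides a b c"
  shows "cos w = (cos c - cos a * cos b) / (sin a * sin b)"
    and "sin w = sqrt (gram a b c) / (sin a * sin b)"
    and "0 < w" and "w < pi"
proof -
  define u where "u = (cos c - cos a * cos b) / (sin a * sin b)"
  have sin: "sin a > 0" "sin b > 0" using a b by (auto intro: sin_gt_zero)
  have w: "w = arccos u"
    unfolding w_def u_def angle_of_sides_eq[OF s] by (rule spherical_law_of_cosines[OF s])
  have "(sin a * sin b)\<^sup>2 - (cos c - cos a * cos b)\<^sup>2 = gram a b c"
    using sin_cos_squared_add[of a] sin_cos_squared_add[of b] unfolding gram_def by algebra
  moreover have "1 - u\<^sup>2 = ((sin a * sin b)\<^sup>2 - (cos c - cos a * cos b)\<^sup>2) / (sin a * sin b)\<^sup>2"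
    unfolding u_def power_divide using sin by (simp add: diff_divide_distrib)
  ultimately have u2: "1 - u\<^sup>2 = gram a b c / (sin a * sin b)\<^sup>2" by simp
  also have "\<dots> > 0" using gram_pos[OF s sin(1)] sin by simp
  finally have u: "-1 < u" "u < 1" using abs_square_less_1[of u] by auto
  show "cos w = (cos c - cos a * cos b) / (sin a * sin b)"
    using u by (simp add: w u_def[symmetric])
  show "sin w = sqrt (gram a b c) / (sin a * sin b)"
    using u sin by (simp add: w sin_arccos u2 real_sqrt_divide)
  show "0 < w" "w < pi"
    unfolding w using arccos_lt_bounded[OF u] by auto
qed

text \<open>
  Let \<open>i\<close>, \<open>j\<close>, \<open>k\<close> be the vertices of a spherical triangle with sides \<open>a = ij\<close>, \<open>b = ik\<close>, \<open>c = jk\<close> and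
  angle \<open>w\<close> at \<open>i\<close>. The left side is the contribution of the triangle to the dual length of the edge
  \<open>ij\<close>, computed at \<open>i\<close>. The right side is unchanged when \<open>i\<close> is exchanged with \<open>j\<close> and \<open>b\<close> with
  \<open>c\<close>, so the same contribution is found at \<open>j\<close>.
\<close>
lemma triangle_foot:
  fixes a b c w G hi hj hk :: real
  assumes "sin a > 0" "sin b > 0" "G > 0"
    and "cos w = (cos c - cos a * cos b) / (sin a * sin b)" "sin w = G / (sin a * sin b)"
  shows "((hk - hi * cos b) / sin b - (hj - hi * cos a) / sin a * cos w) / sin w =
    (hk * (sin a)\<^sup>2 - hj * (cos c - cos a * cos b) - hi * (cos b - cos a * cos c)) / (sin a * G)"
proof -
  have "((hk - hi * cos b) / sin b - (hj - hi * cos a) / sin a * cos w) / sin w =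
    ((hk - hi * cos b) * (sin a)\<^sup>2 - (hj - hi * cos a) * (cos c - cos a * cos b)) / (sin a * G)"
  proof -
    have "(p / q - r / s * (x / (s * q))) / (g / (s * q)) = (p * s\<^sup>2 - r * x) / (s * g)"
      if "q > 0" "s > 0" "g > 0" for p q r s x g :: real
      using that by (simp add: field_simps power2_eq_square)
    from this[OF assms(2,1,3)] show ?thesis unfolding assms(4,5) .
  qed
  also have "(hk - hi * cos b) * (sin a)\<^sup>2 - (hj - hi * cos a) * (cos c - cos a * cos b)
      = hk * (sin a)\<^sup>2 - hj * (cos c - cos a * cos b) - hi * (cos b - cos a * cos c)"
    using sin_cos_squared_add[of a] by algebra
  finally show ?thesis .
qed

lemma triangle_foot_symmetric:
  fixes a b c hi hj hk :: real
  assumes s: "has_sides x y z a b c" and s': "has_sides x' y' z' c a b"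
    and a: "0 < a" "a < pi" and b: "0 < b" "b < pi" and c: "0 < c" "c < pi"
  defines "w \<equiv> angle_of_sides a b c" and "w' \<equiv> angle_of_sides c a b"
  shows "((hk - hi * cos b) / sin b - (hj - hi * cos a) / sin a * cos w) / sin w =
    ((hk - hj * cos c) / sin c - (hi - hj * cos a) / sin a * cos w') / sin w'"
proof -
  have sin: "sin a > 0" "sin b > 0" "sin c > 0" using a b c by (auto intro: sin_gt_zero)
  have G: "sqrt (gram a b c) > 0" using gram_pos[OF s sin(1)] by simp
  have g: "gram c a b = gram a b c" by (simp add: gram_def algebra_simps)
  have 1: "cos w = (cos c - cos a * cos b) / (sin a * sin b)"
    "sin w = sqrt (gram a b c) / (sin a * sin b)"
    using angle_of_sides(1,2)[OF s a b] unfolding w_def .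
  have 2: "cos w' = (cos b - cos a * cos c) / (sin a * sin c)"
    "sin w' = sqrt (gram a b c) / (sin a * sin c)"
    using angle_of_sides(1,2)[OF s' c a] unfolding w'_def g
    by (simp_all only: mult.commute[of "cos c"] mult.commute[of "sin c"])
  show ?thesis
    unfolding triangle_foot[OF sin(1,2) G 1] triangle_foot[OF sin(1,3) G 2]
    by (simp only: diff_diff_eq add.commute)
qed

lemma sphere_triangulationD:
  assumes "sphere_triangulation T"
  shows "opp T (opp T e) = e" and "bij (ccw T)" and "surj (org T)"
    and "org T e = org T e' \<longleftrightarrow> e' \<in> orbit (ccw T) e"
    and "card (orbit (face_next T) e) = 3"
proof -
  note D = assms[unfolded sphere_triangulation_def]
  show "opp T (opp T e) = e" using D[THEN conjunct1] by blast
  show "bij (ccw T)" using D[THEN conjunct2, THEN conjunct1] .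
  show "surj (org T)" using D[THEN conjunct2, THEN conjunct2, THEN conjunct1] .
  show "org T e = org T e' \<longleftrightarrow> e' \<in> orbit (ccw T) e"
    using D[THEN conjunct2, THEN conjunct2, THEN conjunct2, THEN conjunct1] by (elim allE)
  show "card (orbit (face_next T) e) = 3"
    using D[THEN conjunct2, THEN conjunct2, THEN conjunct2, THEN conjunct2, THEN conjunct1]
    unfolding faces_def by blast
qed

section \<open>Dual lengths do not depend on the orientation\<close>
lemma face_next_thrice:
  assumes "sphere_triangulation T"
  shows "face_next T (face_next T (face_next T e)) = e"
proof -
  have "bij (opp T)"
  proof (rule o_bij)
    show "opp T \<circ> opp T = id" "opp T \<circ> opp T = id"
      using sphere_triangulationD(1)[OF assms] by (simp_all add: fun_eq_iff)
  qed
  moreover have "bij (cw T)"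
    using sphere_triangulationD(2)[OF assms] by (simp add: cw_def bij_imp_bij_inv)
  ultimately have "bij (cw T \<circ> opp T)" by (rule bij_comp)
  then have "bij (face_next T)"
    by (simp add: face_next_def[abs_def] comp_def)
  then obtain m where m: "(face_next T ^^ m) e = e"
    "bij_betw (\<lambda>k. (face_next T ^^ k) e) {..<m} (orbit (face_next T) e)"
    using orbit_enum[of "face_next T" e] by blast
  then have "m = 3"
    using bij_betw_same_card[OF m(2)] sphere_triangulationD(5)[OF assms, of e] by simp
  then show ?thesis using m(1) by (simp add: numeral_3_eq_3)
qed

locale fan =
  fixes T :: "('e::finite, 'v::finite) tri_map" and \<phi> :: "'e \<Rightarrow> real"
  assumes fan: "generalized_fan T \<phi>"
begin

lemma tri: "sphere_triangulation T"
  using fan by (simp add: generalized_fan_def)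

lemmas bij_ccw = sphere_triangulationD(2)[OF tri]
  and opp_opp [simp] = sphere_triangulationD(1)[OF tri]
  and surj_org = sphere_triangulationD(3)[OF tri]
  and org_iff = sphere_triangulationD(4)[OF tri]

lemma ccw_cw [simp]: "ccw T (cw T e) = e" and cw_ccw [simp]: "cw T (ccw T e) = e"
  using bij_ccw by (simp_all add: cw_def bij_is_inj bij_is_surj surj_f_inv_f)

lemma org_ccw [simp]: "org T (ccw T e) = org T e"
  using iffD2[OF org_iff orbit.base, of e] by (rule sym)

lemma org_cw [simp]: "org T (cw T e) = org T e"
  using org_ccw[of "cw T e"] by simp

lemma star_eq_orbit: "{e'. org T e' = org T e} = orbit (ccw T) e"
proof (rule set_eqI)
  show "e' \<in> {e'. org T e' = org T e} \<longleftrightarrow> e' \<in> orbit (ccw T) e" for e'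
    using org_iff[of e e'] by (simp add: eq_commute)
qed

lemma face_next_twice: "face_next T (face_next T e) = opp T (ccw T e)"
proof -
  have "cw T (opp T (face_next T (face_next T e))) = e"
    using face_next_thrice[OF tri, of e] by (simp add: face_next_def)
  then show ?thesis by (metis ccw_cw opp_opp)
qed

lemma dest_face_next: "dest T (face_next T e) = dest T (ccw T e)"
  using face_next_twice[of e] by (metis dest_def face_next_def org_cw)

lemma \<phi>: "\<phi> (opp T e) = \<phi> e" "0 < \<phi> e" "\<phi> e < pi" "sin (\<phi> e) > 0"
  and triangle: "\<exists>x y z. has_sides x y z (\<phi> e) (\<phi> (ccw T e)) (\<phi> (face_next T e))"
proof -
  note D = fan[unfolded generalized_fan_def, THEN conjunct2]
  show "\<phi> (opp T e) = \<phi> e" "0 < \<phi> e" "\<phi> e < pi"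
    using D[THEN conjunct1] by simp_all
  then show "sin (\<phi> e) > 0" by (simp add: sin_gt_zero)
  show "\<exists>x y z. has_sides x y z (\<phi> e) (\<phi> (ccw T e)) (\<phi> (face_next T e))"
    using D[THEN conjunct2] by (rule spec)
qed

abbreviation "\<omega> \<equiv> fan_angle T \<phi>"

lemma fan_angle_bounds: "0 < \<omega> e" "\<omega> e < pi"
proof -
  obtain x y z where s: "has_sides x y z (\<phi> e) (\<phi> (ccw T e)) (\<phi> (face_next T e))"
    using triangle by blast
  show "0 < \<omega> e" "\<omega> e < pi"
    unfolding fan_angle_def by (rule angle_of_sides(3,4)[OF s \<phi>(2,3) \<phi>(2,3)])+
qed

abbreviation half_dual_length :: "real^'v \<Rightarrow> 'e \<Rightarrow> real" where
  "half_dual_length h e \<equiv>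
     (edge_alt T \<phi> h (ccw T e) - edge_alt T \<phi> h e * cos (\<omega> e)) / sin (\<omega> e)"

text \<open>
  The triangle to the left of \<open>e\<close> lies to the right of \<open>opp T e\<close>; both its contributions to the dual
  length agree.
\<close>
lemma half_dual_length_opp:
  "half_dual_length h e =
     (edge_alt T \<phi> h (cw T (opp T e)) - edge_alt T \<phi> h (opp T e) * cos (\<omega> (cw T (opp T e))))
       / sin (\<omega> (cw T (opp T e)))"
proof -
  let ?f = "face_next T e"
  have f: "cw T (opp T e) = ?f" "ccw T ?f = opp T e" by (simp_all add: face_next_def)
  have org: "org T ?f = dest T e" by (simp add: face_next_def dest_def)
  obtain x y z where s: "has_sides x y z (\<phi> e) (\<phi> (ccw T e)) (\<phi> ?f)"
    using triangle by blast
  obtain x' y' z' where s': "has_sides x' y' z' (\<phi> ?f) (\<phi> e) (\<phi> (ccw T e))"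
    using triangle[of ?f] by (auto simp: f face_next_twice \<phi>)
  show ?thesis
    using triangle_foot_symmetric[OF s s' \<phi>(2,3) \<phi>(2,3) \<phi>(2,3),
        of "h $ dest T (ccw T e)" "h $ org T e" "h $ dest T e"]
    unfolding f by (simp add: edge_alt_def fan_angle_def f face_next_twice \<phi>(1) org dest_face_next)
      (simp add: dest_def)
qed

lemma dual_length_opp: "dual_length T \<phi> h (opp T e) = dual_length T \<phi> h e"
  using half_dual_length_opp[of h e] half_dual_length_opp[of h "opp T e"]
  by (simp add: dual_length_def)

lemma edge_alt_lin:
  "edge_alt T \<phi> (x + t *\<^sub>R y) e = edge_alt T \<phi> x e + t * edge_alt T \<phi> y e"
  by (simp add: edge_alt_def add_divide_distrib diff_divide_distrib algebra_simps)

section \<open>Mixed volumes and the Hessian\<close>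
definition mixed_area :: "real^'v \<Rightarrow> real^'v \<Rightarrow> 'v \<Rightarrow> real" where
  "mixed_area x y i = 1/2 * (\<Sum>e | org T e = i. edge_alt T \<phi> x e * dual_length T \<phi> y e)"

definition mixed_volume :: "real^'v \<Rightarrow> real^'v \<Rightarrow> real^'v \<Rightarrow> real" where
  "mixed_volume x y z = (\<Sum>i\<in>UNIV. x $ i * mixed_area y z i)"

lemma mixed_area_self: "mixed_area h h i = face_area T \<phi> h i"
  by (simp add: mixed_area_def face_area_def)

lemma mixed_area_cone_form:
  "mixed_area x y (org T e) =
     1/2 * cone_form (ccw T) \<omega> (orbit (ccw T) e) (edge_alt T \<phi> x) (edge_alt T \<phi> y)"
  unfolding mixed_area_def cone_form_def star_eq_orbit dual_length_def slope_jump_def cw_def ..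

lemma org_surj: "\<exists>e. i = org T e"
  using surj_org by (auto simp: surj_def)

lemma mixed_area_commute: "mixed_area x y i = mixed_area y x i"
  using org_surj[of i] cone_form_commute[OF bij_ccw image_orbit[OF bij_ccw]]
  by (auto simp: mixed_area_cone_form)

lemma mixed_area_lin:
  "mixed_area (x + t *\<^sub>R y) z i = mixed_area x z i + t * mixed_area y z i"
  "mixed_area z (x + t *\<^sub>R y) i = mixed_area z x i + t * mixed_area z y i"
proof -
  show "mixed_area (x + t *\<^sub>R y) z i = mixed_area x z i + t * mixed_area y z i" for x y z
    by (simp add: mixed_area_def edge_alt_lin sum.distrib sum_distrib_left algebra_simps)
  then show "mixed_area z (x + t *\<^sub>R y) i = mixed_area z x i + t * mixed_area z y i"
    using mixed_area_commute by metis
qed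

lemma mixed_volume_lin:
  "mixed_volume (x + t *\<^sub>R y) z w = mixed_volume x z w + t * mixed_volume y z w"
  "mixed_volume z (x + t *\<^sub>R y) w = mixed_volume z x w + t * mixed_volume z y w"
  "mixed_volume z w (x + t *\<^sub>R y) = mixed_volume z w x + t * mixed_volume z w y"
  by (simp_all add: mixed_volume_def mixed_area_lin sum.distrib sum_distrib_left algebra_simps)

lemma mixed_volume_commute23: "mixed_volume x y z = mixed_volume x z y"
  by (simp add: mixed_volume_def mixed_area_commute[of y z])

text \<open>
  By \<open>dual_length_opp\<close>, the two orientations of an edge can be put together. Their joint coefficient is
  symmetric in the two families of altitudes.
\<close>
lemma mixed_volume_commute12: "mixed_volume x y z = mixed_volume y x z"
proof -
  have edges: "mixed_volume x y z
      = 1/4 * (\<Sum>e\<in>UNIV. dual_length T \<phi> z e *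
          ((x $ org T e * y $ dest T e + x $ dest T e * y $ org T e
            - (x $ org T e * y $ org T e + x $ dest T e * y $ dest T e) * cos (\<phi> e)) / sin (\<phi> e)))"
    for x y
  proof -
    let ?g = "\<lambda>e. x $ org T e * edge_alt T \<phi> y e * dual_length T \<phi> z e"
    have "x $ i * mixed_area y z i = 1/2 * (\<Sum>e | org T e = i. ?g e)" for i
      unfolding mixed_area_def sum_distrib_left by (intro sum.cong) auto
    then have "mixed_volume x y z = 1/2 * (\<Sum>i\<in>UNIV. \<Sum>e | org T e = i. ?g e)"
      unfolding mixed_volume_def sum_distrib_left by simp
    also have "(\<Sum>i\<in>UNIV. \<Sum>e | org T e = i. ?g e) = (\<Sum>e\<in>UNIV. ?g e)"
      using sum.group[of UNIV UNIV "org T" ?g] by simp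
    also have "\<dots> = 1/2 * ((\<Sum>e\<in>UNIV. ?g e) + (\<Sum>e\<in>UNIV. ?g (opp T e)))"
      using sum.reindex_bij_witness[of UNIV "opp T" "opp T" UNIV "\<lambda>e. ?g (opp T e)" ?g] by simp
    also have "(\<Sum>e\<in>UNIV. ?g e) + (\<Sum>e\<in>UNIV. ?g (opp T e)) = (\<Sum>e\<in>UNIV. dual_length T \<phi> z e *
          ((x $ org T e * y $ dest T e + x $ dest T e * y $ org T e
            - (x $ org T e * y $ org T e + x $ dest T e * y $ dest T e) * cos (\<phi> e)) / sin (\<phi> e)))"
      unfolding sum.distrib[symmetric] dual_length_opp
      by (intro sum.cong refl)
        (simp add: edge_alt_def dest_def \<phi>(1) add_divide_distrib diff_divide_distrib algebra_simps)
    finally show ?thesis by simp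
  qed
  show ?thesis
    unfolding edges by (simp add: algebra_simps)
qed

lemma mixed_volume_axis: "mixed_volume (axis i 1) y z = mixed_area y z i"
  by (simp add: mixed_volume_def axis_def if_distrib[where f = "\<lambda>t. t * _"] cong: if_cong)

lemma vol_eq_mixed_volume: "vol T \<phi> h = 1/3 * mixed_volume h h h"
  by (simp add: vol_def mixed_volume_def mixed_area_self)

text \<open>
  Along a coordinate line the volume is a cubic polynomial whose linear coefficient, by symmetry of
  the mixed volume, is the mixed volume with the coordinate vector.
\<close>
lemma partial_vol: "partial i (vol T \<phi>) = (\<lambda>x. face_area T \<phi> x i)"
proof
  fix x :: "real^'v"
  let ?a = "axis i 1 :: real^'v"
  have "vol T \<phi> (x + t *\<^sub>R ?a) = 1/3 * mixed_volume x x x + t * mixed_volume ?a x x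
      + t\<^sup>2 * mixed_volume ?a ?a x + t ^ 3 * (1/3 * mixed_volume ?a ?a ?a)" for t
    unfolding vol_eq_mixed_volume mixed_volume_lin
    using mixed_volume_commute12[of x ?a x] mixed_volume_commute23[of x x ?a]
      mixed_volume_commute12[of x ?a ?a] mixed_volume_commute23[of ?a x ?a]
    by (simp add: power2_eq_square power3_eq_cube algebra_simps)
  then have "((\<lambda>t. vol T \<phi> (x + t *\<^sub>R ?a)) has_real_derivative mixed_volume ?a x x) (at 0)"
    by (auto intro!: derivative_eq_intros)
  then show "partial i (vol T \<phi>) x = face_area T \<phi> x i"
    unfolding partial_def mixed_volume_axis mixed_area_self by (rule DERIV_imp_deriv)
qed

lemma hessian_vol: "hessian (vol T \<phi>) h $ i $ j = 2 * mixed_area h (axis i 1) j"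
proof -
  let ?a = "axis i 1 :: real^'v"
  have "face_area T \<phi> (h + t *\<^sub>R ?a) j = mixed_area h h j + t * (2 * mixed_area h ?a j)
      + t\<^sup>2 * mixed_area ?a ?a j" for t
    unfolding mixed_area_self[symmetric] mixed_area_lin
    using mixed_area_commute[of ?a h] by (simp add: power2_eq_square algebra_simps)
  then have "((\<lambda>t. face_area T \<phi> (h + t *\<^sub>R ?a) j) has_real_derivative 2 * mixed_area h ?a j) (at 0)"
    by (auto intro!: derivative_eq_intros)
  then show ?thesis
    by (simp add: hessian_def partial_vol) (simp add: partial_def DERIV_imp_deriv)
qed

text \<open>
  The symmetry of the mixed volume turns the kernel of the Hessian into a condition at each
  single vertex: \<open>v\<close> is orthogonal to \<open>h\<close> with respect to every mixed area.
\<close>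
lemma hessian_vol_mult: "(hessian (vol T \<phi>) h *v v) $ i = 2 * mixed_area h v i"
proof -
  have "(hessian (vol T \<phi>) h *v v) $ i = 2 * mixed_volume v h (axis i 1)"
    by (simp add: matrix_vector_mult_def hessian_vol mixed_volume_def sum_distrib_left algebra_simps)
  also have "\<dots> = 2 * mixed_area h v i"
    using mixed_volume_commute23[of v h] mixed_volume_commute12[of v] mixed_volume_commute23[of "axis i 1" v h]
    by (simp add: mixed_volume_axis)
  finally show ?thesis .
qed

lemma mixed_area_lorentzian:
  assumes "curvature T \<phi> i > 0" "face_area T \<phi> h i > 0" "mixed_area h v i = 0"
  shows "mixed_area v v i \<le> 0"
    and "mixed_area v v i = 0 \<Longrightarrow> org T e = i \<Longrightarrow> edge_alt T \<phi> v e = 0"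
proof -
  obtain d where d: "i = org T d" using org_surj by blast
  interpret cone_angles "ccw T" \<omega> d
    using bij_ccw fan_angle_bounds assms(1)
    by unfold_locales (simp_all add: curvature_def d star_eq_orbit)
  have Q: "Q (edge_alt T \<phi> h) (edge_alt T \<phi> h) > 0" "Q (edge_alt T \<phi> h) (edge_alt T \<phi> v) = 0"
    using assms(2,3) by (simp_all add: d mixed_area_cone_form mixed_area_self[symmetric])
  show "mixed_area v v i \<le> 0"
    using nonpos_on_orthogonal[OF Q] by (simp add: d mixed_area_cone_form)
  show "edge_alt T \<phi> v e = 0" if "mixed_area v v i = 0" "org T e = i"
    using definite_on_orthogonal[OF Q, of e] that star_eq_orbit[of d]
    by (auto simp: d mixed_area_cone_form)
qed

text \<open>
  Along an edge, \<open>v\<close> is multiplied by \<open>cos (\<phi> e)\<close> in either direction, and \<open>\<bar>cos (\<phi> e)\<bar> < 1\<close>.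
\<close>
lemma edge_alt_zero_imp_zero:
  assumes "\<And>e. edge_alt T \<phi> v e = 0"
  shows "v = 0"
proof -
  have "v $ org T e = 0" for e
  proof -
    have "v $ dest T e = v $ org T e * cos (\<phi> e)"
      using assms[of e] \<phi>(4)[of e] by (simp add: edge_alt_def)
    moreover have "v $ org T e = v $ dest T e * cos (\<phi> e)"
      using assms[of "opp T e"] \<phi>(4)[of e] by (simp add: edge_alt_def dest_def \<phi>(1))
    ultimately have "v $ org T e * (sin (\<phi> e))\<^sup>2 = 0"
      using sin_cos_squared_add[of "\<phi> e"] by algebra
    then show ?thesis using \<phi>(4)[of e] by simp
  qed
  then show ?thesis using org_surj by (metis vec_eq_iff zero_index)
qed

end

theorem theorem5:
  fixes T :: "('e::finite, 'v::finite) tri_map"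
    and \<phi> :: "'e \<Rightarrow> real"
    and h :: "real^'v"
  assumes "generalized_convex_polyhedron T \<phi> h"
    and "\<And>i. curvature T \<phi> i > 0"
    and "\<And>i. h $ i > 0"
    and "\<And>i. face_area T \<phi> h i > 0"
  shows "det (hessian (vol T \<phi>) h) \<noteq> 0"
proof -
  interpret fan T \<phi>
    using assms(1) by unfold_locales (simp add: generalized_convex_polyhedron_def)
  have "v = 0" if "hessian (vol T \<phi>) h *v v = 0" for v
  proof (rule edge_alt_zero_imp_zero)
    fix e
    have ortho: "mixed_area h v i = 0" for i
      using hessian_vol_mult[of h v i] that by simp
    note lorentz = mixed_area_lorentzian[OF assms(2,4) ortho]
    have "(\<Sum>i\<in>UNIV. h $ i * mixed_area v v i) = mixed_volume v h v"
      unfolding mixed_volume_commute12[of v h] by (simp add: mixed_volume_def)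
    also have "\<dots> = 0"
      by (simp add: mixed_volume_def ortho)
    finally have "(\<Sum>i\<in>UNIV. - (h $ i * mixed_area v v i)) = 0"
      by (simp add: sum_negf)
    then have zero: "- (h $ i * mixed_area v v i) = 0" for i
      using assms(3) lorentz(1)
      by (subst (asm) sum_nonneg_eq_0_iff) (auto simp: mult_nonneg_nonpos less_imp_le)
    have "mixed_area v v (org T e) = 0"
      using zero[of "org T e"] assms(3)[of "org T e"] by auto
    then show "edge_alt T \<phi> v e = 0"
      using lorentz(2) by blast
  qed
  then show ?thesis
    unfolding invertible_det_nz[symmetric] invertible_left_inverse matrix_left_invertible_ker by blast
qed

end
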